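(* Let $H_1\cong H_2\cong(\mathbb{C}^2)^{\otimes n}$, let $\rho$ be a density matrix, let $\tilde U$ be a unitary on $(\mathbb{C}^2)^{\otimes n}$, and let $\mathcal{E}(X)=\tilde UX\tilde U^\dagger$. Let $M=\sum_{i,j}|i\rangle\langle j|\otimes\mathcal{E}(|j\rangle\langle i|)$, let $R=\frac12\big((\rho\otimes\mathbb{1})M+M(\rho\otimes\mathbb{1})\big)$, let $S=\sum_{i,j}|ij\rangle\langle ji|$ be the swap operator, let $\bar R=SRS^\dagger$, and let $\gamma=\mathcal{E}(\rho)$. Then $$\bar R=\tfrac12\big((\gamma\otimes\mathbb{1})\bar M+\bar M(\gamma\otimes\mathbb{1})\big)\quad\text{with}\quad \bar M=\sum_{i,j}|i\rangle\langle j|\otimes\tilde U^\dagger|j\rangle\langle i|\tilde U,$$ i.e. the time-reversed pseudo-density matrix $\bar R$ has the pseudo-density-matrix form with initial state $\gamma$ and the inverse unitary channel $X\mapsto\tilde U^\dagger X\tilde U$. Moreover both Choi matrices $M^{T_1}$ and $\bar M^{T_1}$ are positive semidefinite.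
   Context: All sums run over the computational basis labels $0,\dots,2^n-1$. For a linear map $\mathcal{F}$ on $n$-qubit operators, its Choi–Jamiołkowski matrix is $\sum_{i,j}|i\rangle\langle j|\otimes\mathcal{F}(|j\rangle\langle i|)$, and $T_1$ denotes the transpose on the first tensor factor in the computational basis. The two-time pseudo-density matrix of a process with initial state $\omega$ and channel with Choi–Jamiołkowski matrix $N$ is $\frac12\big((\omega\otimes\mathbb{1})N+N(\omega\otimes\mathbb{1})\big)$; conjugation by the swap operator exchanges the two time labels. *)

theory Defs
  imports "Jordan_Normal_Form.Schur_Decomposition"
begin

definition mat_trace :: "complex mat \<Rightarrow> complex" where
  "mat_trace A = (\<Sum>i<dim_row A. A $$ (i, i))"

text \<open>On complex numbers \<open>0 \<le> z\<close> is the order of \<^theory>\<open>HOL-Library.Complex_Order\<close>: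
  \<open>z\<close> is real and nonnegative.\<close>

definition psd_mat :: "nat \<Rightarrow> complex mat \<Rightarrow> bool" where
  "psd_mat d A \<longleftrightarrow> A \<in> carrier_mat d d \<and> mat_adjoint A = A \<and>
     (\<forall>v \<in> carrier_vec d. 0 \<le> (A *\<^sub>v v) \<bullet>c v)"

definition density_mat :: "nat \<Rightarrow> complex mat \<Rightarrow> bool" where
  "density_mat d A \<longleftrightarrow> psd_mat d A \<and> mat_trace A = 1"

definition unitary_mat :: "nat \<Rightarrow> complex mat \<Rightarrow> bool" where
  "unitary_mat d U \<longleftrightarrow> U \<in> carrier_mat d d \<and>
     mat_adjoint U * U = 1\<^sub>m d \<and> U * mat_adjoint U = 1\<^sub>m d"

text \<open>Tensor products, with the label pair \<open>(i, j)\<close> encoded as \<open>i * d + j\<close>,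
  where \<open>d\<close> is the size of the second factor.\<close>

definition kron_vec :: "complex vec \<Rightarrow> complex vec \<Rightarrow> complex vec" where
  "kron_vec v w = vec (dim_vec v * dim_vec w)
     (\<lambda>k. v $ (k div dim_vec w) * w $ (k mod dim_vec w))"

definition kron_mat :: "complex mat \<Rightarrow> complex mat \<Rightarrow> complex mat" where
  "kron_mat A B = mat (dim_row A * dim_row B) (dim_col A * dim_col B)
     (\<lambda>(k, l). A $$ (k div dim_row B, l div dim_col B) * B $$ (k mod dim_row B, l mod dim_col B))"

text \<open>The operator \<open>|v\<rangle>\<langle>w|\<close>.\<close>

definition ket_bra :: "complex vec \<Rightarrow> complex vec \<Rightarrow> complex mat" where
  "ket_bra v w = mat (dim_vec v) (dim_vec w) (\<lambda>(k, l). v $ k * conjugate (w $ l))"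

abbreviation msum :: "nat \<Rightarrow> ('a \<Rightarrow> complex mat) \<Rightarrow> 'a set \<Rightarrow> complex mat" where
  "msum d f I \<equiv> finsum (module_mat TYPE(complex) d d) f I"

definition choi_jamiolkowski :: "nat \<Rightarrow> (complex mat \<Rightarrow> complex mat) \<Rightarrow> complex mat" where
  "choi_jamiolkowski d F = msum (d * d)
     (\<lambda>(i, j). kron_mat (ket_bra (unit_vec d i) (unit_vec d j))
                        (F (ket_bra (unit_vec d j) (unit_vec d i))))
     ({0..<d} \<times> {0..<d})"

definition pseudo_density :: "nat \<Rightarrow> complex mat \<Rightarrow> complex mat \<Rightarrow> complex mat" where
  "pseudo_density d \<omega> N =
     (1 / 2) \<cdot>\<^sub>m (kron_mat \<omega> (1\<^sub>m d) * N + N * kron_mat \<omega> (1\<^sub>m d))"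

definition swap_mat :: "nat \<Rightarrow> complex mat" where
  "swap_mat d = msum (d * d)
     (\<lambda>(i, j). ket_bra (kron_vec (unit_vec d i) (unit_vec d j))
                       (kron_vec (unit_vec d j) (unit_vec d i)))
     ({0..<d} \<times> {0..<d})"

text \<open>Transpose on the first factor: the quotients by \<open>d\<close> of the row and column labels are
  exchanged, the remainders stay.\<close>

definition transpose_fst :: "nat \<Rightarrow> complex mat \<Rightarrow> complex mat" where
  "transpose_fst d A = mat (d * d) (d * d)
     (\<lambda>(k, l). A $$ ((l div d) * d + k mod d, (k div d) * d + l mod d))"

end

(* With pairs (a, b) labelling rows and (c, e) labelling columns, and V' the adjoint of V, the
   channel X |-> V X V' has M[(a,b),(c,e)] = V[b,c] * cnj V[e,a].  Hence M with the first factor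
   transposed is the rank-one matrix |vec V><vec V|, and multiplying by \<omega> on the first factor
   gives R[(a,b),(c,e)] = 1/2 (V[b,c] (\<omega> V')[a,e] + (V \<omega>)[b,c] V'[a,e]).
   The swap exchanges a with b and c with e; since \<gamma> U = U \<rho> and U' \<gamma> = \<rho> U' for
   \<gamma> = U \<rho> U', it turns this formula for (U, \<rho>) into the one for (U', \<gamma>). *)
theory Submission
  imports Defs
begin

section \<open>Index calculus\<close>

text \<open>Closure and entries go through one induction, because reading off an entry of
  \<open>f i + msum d f I\<close> needs the dimensions of the partial sum.\<close>

lemma msum_closed_index:
  assumes "finite I" "\<And>i. i \<in> I \<Longrightarrow> f i \<in> carrier_mat d d"
  shows "msum d f I \<in> carrier_mat d d \<and>
    (\<forall>k<d. \<forall>l<d. msum d f I $$ (k, l) = (\<Sum>i\<in>I. f i $$ (k, l)))"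
proof -
  interpret A: abelian_group "module_mat TYPE(complex) d d" by (rule abelian_group_mat)
  show ?thesis
    using assms
  proof (induction I rule: finite_induct)
    case empty
    then show ?case by (simp add: module_mat_simps)
  next
    case (insert i I)
    have "msum d f (insert i I) = f i + msum d f I"
      using insert by (subst A.finsum_insert) (auto simp: module_mat_simps)
    moreover have "msum d f I \<in> carrier_mat d d" using insert by blast
    ultimately show ?case using insert by auto
  qed
qed

lemmas msum_closed = msum_closed_index[THEN conjunct1]
  and msum_index = msum_closed_index[THEN conjunct2, rule_format]

lemma div_mod_less_square:
  fixes k d :: nat
  assumes "k < d * d"
  shows "k div d < d" "k mod d < d"
proof -
  have "0 < d" using assms by (cases d) auto
  then show "k div d < d" "k mod d < d"
    using assms by (auto simp: less_mult_imp_div_less)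
qed

lemma pair_less_square:
  fixes i j d :: nat
  assumes "i < d" "j < d"
  shows "i * d + j < d * d"
proof -
  have "i * d + j < Suc i * d" using assms by simp
  also have "\<dots> \<le> d * d" using assms by (intro mult_le_mono1) simp
  finally show ?thesis .
qed

text \<open>The range splits into d consecutive blocks of length d, block i holding the labels of
  the pairs (i, j). This turns the inner sum of a product of d*d-dimensional matrices into a sum
  over pairs.\<close>

lemma sum_square_pairs:
  fixes d :: nat and f :: "nat \<Rightarrow> complex"
  shows "(\<Sum>k<d * d. f k) = (\<Sum>i<d. \<Sum>j<d. f (i * d + j))"
proof -
  have "(\<Sum>k = i * d..<i * d + d. f k) = (\<Sum>j<d. f (i * d + j))" for i
    using sum.shift_bounds_nat_ivl[of f 0 "i * d" d]
    by (simp add: atLeast0LessThan add.commute)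
  then show ?thesis using sum.nat_group[of f d d] by simp
qed

section \<open>Entries of products and algebra of adjoints\<close>

lemma mat_mult_index:
  assumes "A \<in> carrier_mat m n" "B \<in> carrier_mat n p" "i < m" "j < p"
  shows "(A * B) $$ (i, j) = (\<Sum>k<n. A $$ (i, k) * B $$ (k, j))"
  using assms by (simp add: scalar_prod_def atLeast0LessThan)

lemma dim_mat_adjoint [simp]:
  "dim_row (mat_adjoint A) = dim_col A" "dim_col (mat_adjoint A) = dim_row A"
  by (simp_all add: mat_adjoint_def)

lemma mat_adjoint_carrier [simp]:
  "A \<in> carrier_mat m n \<Longrightarrow> mat_adjoint A \<in> carrier_mat n m"
  by auto

lemma mat_adjoint_index:
  "\<lbrakk>A \<in> carrier_mat m n; i < n; j < m\<rbrakk> \<Longrightarrow> mat_adjoint A $$ (i, j) = cnj (A $$ (j, i))"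
  by (auto simp: mat_adjoint_def mat_of_rows_index)

lemma mat_adjoint_mat_adjoint:
  fixes A :: "complex mat"
  assumes "A \<in> carrier_mat m n"
  shows "mat_adjoint (mat_adjoint A) = A"
proof -
  have A': "mat_adjoint A \<in> carrier_mat n m" using assms by simp
  show ?thesis
    by (rule eq_matI)
      (use assms in \<open>auto simp: mat_adjoint_index[OF A'] mat_adjoint_index[OF assms]\<close>)
qed

lemma mat_adjoint_mult:
  fixes A B :: "complex mat"
  assumes A: "A \<in> carrier_mat m n" and B: "B \<in> carrier_mat n p"
  shows "mat_adjoint (A * B) = mat_adjoint B * mat_adjoint A"
proof (rule eq_matI)
  have AB: "A * B \<in> carrier_mat m p" using A B by simp
  have A': "mat_adjoint A \<in> carrier_mat n m" and B': "mat_adjoint B \<in> carrier_mat p n"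
    using A B by simp_all
  fix i j
  assume "i < dim_row (mat_adjoint B * mat_adjoint A)" "j < dim_col (mat_adjoint B * mat_adjoint A)"
  then have ij: "i < p" "j < m" using A' B' by auto
  show "mat_adjoint (A * B) $$ (i, j) = (mat_adjoint B * mat_adjoint A) $$ (i, j)"
    by (simp add: mat_adjoint_index[OF AB ij] mat_mult_index[OF A B ij(2,1)]
        mat_mult_index[OF B' A' ij] mat_adjoint_index[OF A] mat_adjoint_index[OF B] ij mult.commute
        del: index_mult_mat)
qed (use A B in auto)

lemma unitary_mat_adjoint: "unitary_mat d U \<Longrightarrow> unitary_mat d (mat_adjoint U)"
  by (auto simp: unitary_mat_def mat_adjoint_mat_adjoint)

section \<open>Positivity and trace\<close>

lemma cscalar_prod_mat_adjoint:
  fixes A :: "complex mat"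
  assumes A: "A \<in> carrier_mat m n" and v: "v \<in> carrier_vec n" and w: "w \<in> carrier_vec m"
  shows "(A *\<^sub>v v) \<bullet>c w = v \<bullet>c (mat_adjoint A *\<^sub>v w)"
proof -
  have "(A *\<^sub>v v) \<bullet>c w = (\<Sum>i<m. \<Sum>j<n. A $$ (i, j) * v $ j * cnj (w $ i))"
    using A v w by (simp add: scalar_prod_def sum_distrib_right atLeast0LessThan)
  also have "\<dots> = (\<Sum>j<n. \<Sum>i<m. A $$ (i, j) * v $ j * cnj (w $ i))"
    by (rule sum.swap)
  also have "\<dots> = v \<bullet>c (mat_adjoint A *\<^sub>v w)"
  proof -
    have "conjugate ((mat_adjoint A *\<^sub>v w) $ j) = (\<Sum>i<m. A $$ (i, j) * cnj (w $ i))"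
      if "j < n" for j
      using A w that mat_adjoint_index[OF A that]
      by (simp add: scalar_prod_def atLeast0LessThan)
    then have "v \<bullet>c (mat_adjoint A *\<^sub>v w)
        = (\<Sum>j<n. v $ j * (\<Sum>i<m. A $$ (i, j) * cnj (w $ i)))"
      using A by (simp add: scalar_prod_def[of v] atLeast0LessThan del: index_mult_mat_vec)
    then show ?thesis by (simp add: sum_distrib_left ac_simps)
  qed
  finally show ?thesis .
qed

text \<open>The quadratic form of B A B' at v is the form of A at B' v, where B' is the adjoint of
  B.\<close>

lemma psd_mat_conjugation:
  assumes B: "B \<in> carrier_mat m d" and A: "psd_mat d A"
  shows "psd_mat m (B * A * mat_adjoint B)"
proof -
  have Ac: "A \<in> carrier_mat d d" and Ah: "mat_adjoint A = A"
    and An: "\<And>v. v \<in> carrier_vec d \<Longrightarrow> 0 \<le> (A *\<^sub>v v) \<bullet>c v"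
    using A by (auto simp: psd_mat_def)
  have B': "mat_adjoint B \<in> carrier_mat d m" and BA: "B * A \<in> carrier_mat m d"
    using Ac B by simp_all
  have "mat_adjoint (B * A * mat_adjoint B) = B * (A * mat_adjoint B)"
    by (simp add: mat_adjoint_mult[OF BA B'] mat_adjoint_mult[OF B Ac] mat_adjoint_mat_adjoint[OF B] Ah)
  then have herm: "mat_adjoint (B * A * mat_adjoint B) = B * A * mat_adjoint B"
    by (simp add: assoc_mult_mat[OF B Ac B'])
  have "0 \<le> ((B * A * mat_adjoint B) *\<^sub>v v) \<bullet>c v" if v: "v \<in> carrier_vec m" for v
  proof -
    have Bv: "mat_adjoint B *\<^sub>v v \<in> carrier_vec d" using B' v by simp
    have "(B * A * mat_adjoint B) *\<^sub>v v = B *\<^sub>v (A *\<^sub>v (mat_adjoint B *\<^sub>v v))"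
      by (simp only: assoc_mult_mat_vec[OF BA B' v] assoc_mult_mat_vec[OF B Ac Bv])
    then show ?thesis
      using An[OF Bv] Ac Bv by (simp add: cscalar_prod_mat_adjoint[OF B _ v])
  qed
  then show ?thesis using herm BA B' by (simp add: psd_mat_def)
qed

lemma ket_bra_carrier [simp]:
  "\<lbrakk>v \<in> carrier_vec m; w \<in> carrier_vec n\<rbrakk> \<Longrightarrow> ket_bra v w \<in> carrier_mat m n"
  by (auto simp: ket_bra_def)

text \<open>The quadratic form at v is a double sum that factors as \<open>z * cnj z\<close>, with
  \<open>z\<close> the inner product of w and v; it is the squared modulus of
  \<open>z\<close>.\<close>

lemma psd_mat_ket_bra:
  assumes w: "w \<in> carrier_vec m"
  shows "psd_mat m (ket_bra w w)"
proof -
  have K: "ket_bra w w \<in> carrier_mat m m" using w by simp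
  have herm: "mat_adjoint (ket_bra w w) = ket_bra w w"
    by (rule eq_matI) (use w K mat_adjoint_index[OF K] in \<open>auto simp: ket_bra_def\<close>)
  have "0 \<le> (ket_bra w w *\<^sub>v v) \<bullet>c v" if v: "v \<in> carrier_vec m" for v
  proof -
    define z where "z = (\<Sum>i<m. w $ i * cnj (v $ i))"
    have "(ket_bra w w *\<^sub>v v) \<bullet>c v = (\<Sum>i<m. (\<Sum>j<m. w $ i * cnj (w $ j) * v $ j) * cnj (v $ i))"
      using v w by (simp add: scalar_prod_def ket_bra_def atLeast0LessThan)
    also have "\<dots> = z * cnj z"
      by (simp add: z_def sum_product) (simp add: sum_distrib_left sum_distrib_right ac_simps)
    also have "0 \<le> z * cnj z"
      by (simp add: complex_mult_cnj less_eq_complex_def)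
    finally show ?thesis .
  qed
  then show ?thesis using herm K by (simp add: psd_mat_def)
qed

section \<open>Cyclicity of the trace and density matrices\<close>

lemma mat_trace_mult_comm:
  assumes A: "A \<in> carrier_mat m n" and B: "B \<in> carrier_mat n m"
  shows "mat_trace (A * B) = mat_trace (B * A)"
proof -
  have "mat_trace (A * B) = (\<Sum>i<m. \<Sum>k<n. A $$ (i, k) * B $$ (k, i))"
    using A B by (simp add: mat_trace_def mat_mult_index[OF A B] del: index_mult_mat(1))
  also have "\<dots> = (\<Sum>k<n. \<Sum>i<m. A $$ (i, k) * B $$ (k, i))"
    by (rule sum.swap)
  also have "\<dots> = mat_trace (B * A)"
    using A B by (simp add: mat_trace_def mat_mult_index[OF B A] mult.commute del: index_mult_mat(1))
  finally show ?thesis .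
qed

text \<open>Cyclicity moves U' to the front of the trace, where it cancels against U; positivity is
  preserved by conjugation with any matrix.\<close>

lemma density_mat_unitary_conjugation:
  assumes U: "unitary_mat d U" and rho: "density_mat d \<rho>"
  shows "density_mat d (U * \<rho> * mat_adjoint U)"
proof -
  have Uc: "U \<in> carrier_mat d d" and UU: "mat_adjoint U * U = 1\<^sub>m d"
    and rc: "\<rho> \<in> carrier_mat d d"
    using U rho by (auto simp: unitary_mat_def density_mat_def psd_mat_def)
  have Uc': "mat_adjoint U \<in> carrier_mat d d" using Uc by simp
  have "mat_trace (U * \<rho> * mat_adjoint U) = mat_trace (mat_adjoint U * (U * \<rho>))"
    using Uc rc by (intro mat_trace_mult_comm[of _ d d]) simp_all
  also have "mat_adjoint U * (U * \<rho>) = \<rho>"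
    unfolding assoc_mult_mat[OF Uc' Uc rc, symmetric] UU by (rule left_mult_one_mat[OF rc])
  finally show ?thesis
    using rho psd_mat_conjugation[OF Uc] by (auto simp: density_mat_def)
qed

section \<open>Unitary channels and their pseudo-density matrices\<close>

text \<open>For X = \<rho> these are U' \<gamma> = \<rho> U' and \<gamma> U = U \<rho>, the
  intertwining relations behind the time reversal. The first also gives the inverse channel.\<close>

lemma unitary_conjugation_cancel:
  assumes U: "unitary_mat d U" and X: "X \<in> carrier_mat d d"
  shows "mat_adjoint U * (U * X * mat_adjoint U) = X * mat_adjoint U"
    and "U * X * mat_adjoint U * U = U * X"
proof -
  have c: "U \<in> carrier_mat d d" "mat_adjoint U \<in> carrier_mat d d"
    and UU: "mat_adjoint U * U = 1\<^sub>m d"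
    using U by (auto simp: unitary_mat_def)
  have "mat_adjoint U * (U * X * mat_adjoint U) = (mat_adjoint U * U) * X * mat_adjoint U"
    using c X by (simp add: assoc_mult_mat[of _ d d _ d _ d])
  then show "mat_adjoint U * (U * X * mat_adjoint U) = X * mat_adjoint U"
    using X by (simp add: UU)
  have "U * X * mat_adjoint U * U = U * X * (mat_adjoint U * U)"
    using c X by (intro assoc_mult_mat[of _ d d _ d _ d] mult_carrier_mat)
  also have "\<dots> = U * X"
    unfolding UU by (rule right_mult_one_mat[OF mult_carrier_mat[OF c(1) X]])
  finally show "U * X * mat_adjoint U * U = U * X" .
qed

lemma unitary_conjugation_inverse:
  assumes U: "unitary_mat d U" and X: "X \<in> carrier_mat d d"
  shows "mat_adjoint U * (U * X * mat_adjoint U) * U = X"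
proof -
  have c: "U \<in> carrier_mat d d" "mat_adjoint U \<in> carrier_mat d d"
    and UU: "mat_adjoint U * U = 1\<^sub>m d"
    using U by (auto simp: unitary_mat_def)
  show ?thesis
    unfolding unitary_conjugation_cancel(1)[OF U X] assoc_mult_mat[OF X c(2,1)] UU
    using X by simp
qed

section \<open>Choi-Jamiolkowski and pseudo-density matrices of unitary channels\<close>

lemma kron_mat_carrier:
  "\<lbrakk>A \<in> carrier_mat m n; B \<in> carrier_mat p q\<rbrakk> \<Longrightarrow> kron_mat A B \<in> carrier_mat (m * p) (n * q)"
  by (auto simp: kron_mat_def)

text \<open>The factor |i><j| has a single nonzero entry, so only the summand with i =
  \<open>k div d\<close> and j = \<open>l div d\<close> reaches the entry (k, l). The channel is
  applied to |j><i|, hence the reversed order of the two quotients.\<close>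

lemma choi_jamiolkowski_closed_index:
  assumes F: "\<And>X. X \<in> carrier_mat d d \<Longrightarrow> F X \<in> carrier_mat d d"
  shows "choi_jamiolkowski d F \<in> carrier_mat (d * d) (d * d) \<and>
    (\<forall>k<d * d. \<forall>l<d * d. choi_jamiolkowski d F $$ (k, l) =
      F (ket_bra (unit_vec d (l div d)) (unit_vec d (k div d))) $$ (k mod d, l mod d))"
proof -
  define f where "f = (\<lambda>(i, j). kron_mat (ket_bra (unit_vec d i) (unit_vec d j))
                        (F (ket_bra (unit_vec d j) (unit_vec d i))))"
  have Fc: "F (ket_bra (unit_vec d j) (unit_vec d i)) \<in> carrier_mat d d" for i j
    by (intro F ket_bra_carrier) simp_all
  have fc: "f p \<in> carrier_mat (d * d) (d * d)" for p
    using Fc by (auto simp: f_def intro!: kron_mat_carrier split: prod.splits)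
  have C: "choi_jamiolkowski d F = msum (d * d) f ({0..<d} \<times> {0..<d})"
    by (simp add: choi_jamiolkowski_def f_def)
  have "choi_jamiolkowski d F $$ (k, l) =
      F (ket_bra (unit_vec d (l div d)) (unit_vec d (k div d))) $$ (k mod d, l mod d)"
    if k: "k < d * d" and l: "l < d * d" for k l
  proof -
    note b = div_mod_less_square[OF k] div_mod_less_square[OF l]
    have fi: "f p $$ (k, l) = (if p = (k div d, l div d)
        then F (ket_bra (unit_vec d (l div d)) (unit_vec d (k div d))) $$ (k mod d, l mod d) else 0)"
      if "p \<in> {0..<d} \<times> {0..<d}" for p
      using that k l b Fc[THEN carrier_matD(1)] Fc[THEN carrier_matD(2)]
      by (cases p) (simp add: f_def kron_mat_def, simp add: ket_bra_def)
    show ?thesis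
      unfolding C using b k l
      by (subst msum_index) (simp_all add: fc fi sum.delta)
  qed
  moreover have "choi_jamiolkowski d F \<in> carrier_mat (d * d) (d * d)"
    unfolding C by (rule msum_closed) (simp_all add: fc)
  ultimately show ?thesis by blast
qed

text \<open>V |c><a| V' is the outer product of columns c and a of V.\<close>

lemma conjugation_ket_bra_unit_vec_index:
  assumes V: "V \<in> carrier_mat d d" and i: "i < d" "j < d" "a < d" "c < d"
  shows "(V * ket_bra (unit_vec d c) (unit_vec d a) * mat_adjoint V) $$ (i, j)
    = V $$ (i, c) * cnj (V $$ (j, a))"
proof -
  have K: "ket_bra (unit_vec d c) (unit_vec d a) \<in> carrier_mat d d" by simp
  have V': "mat_adjoint V \<in> carrier_mat d d" using V by simp
  have VK: "V * ket_bra (unit_vec d c) (unit_vec d a) \<in> carrier_mat d d" using V K by simp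
  have "(V * ket_bra (unit_vec d c) (unit_vec d a)) $$ (i, m) = (if m = a then V $$ (i, c) else 0)"
    if "m < d" for m
  proof -
    have "(V * ket_bra (unit_vec d c) (unit_vec d a)) $$ (i, m)
        = (\<Sum>k<d. if k = c then (if m = a then V $$ (i, c) else 0) else 0)"
      unfolding mat_mult_index[OF V K i(1) that]
      by (rule sum.cong) (use i that in \<open>auto simp: ket_bra_def\<close>)
    then show ?thesis using i by simp
  qed
  then have "(V * ket_bra (unit_vec d c) (unit_vec d a) * mat_adjoint V) $$ (i, j)
      = (\<Sum>m<d. if m = a then V $$ (i, c) * cnj (V $$ (j, a)) else 0)"
    unfolding mat_mult_index[OF VK V' i(1,2)]
    by (intro sum.cong) (use i in \<open>auto simp: mat_adjoint_index[OF V] simp del: index_mult_mat\<close>)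
  then show ?thesis using i by simp
qed

lemma choi_unitary_carrier:
  assumes "V \<in> carrier_mat d d"
  shows "choi_jamiolkowski d (\<lambda>X. V * X * mat_adjoint V) \<in> carrier_mat (d * d) (d * d)"
  by (rule choi_jamiolkowski_closed_index[THEN conjunct1])
    (use assms in \<open>auto intro!: mult_carrier_mat mat_adjoint_carrier\<close>)

lemma choi_unitary_index:
  assumes V: "V \<in> carrier_mat d d" and k: "k < d * d" and l: "l < d * d"
  shows "choi_jamiolkowski d (\<lambda>X. V * X * mat_adjoint V) $$ (k, l)
    = V $$ (k mod d, l div d) * cnj (V $$ (l mod d, k div d))"
proof -
  have c: "V * X * mat_adjoint V \<in> carrier_mat d d" if "X \<in> carrier_mat d d" for X
    using V that by (auto intro!: mult_carrier_mat mat_adjoint_carrier)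
  show ?thesis
    using choi_jamiolkowski_closed_index[of d "\<lambda>X. V * X * mat_adjoint V", OF c] k l
      div_mod_less_square[OF k] div_mod_less_square[OF l]
    by (simp add: conjugation_ket_bra_unit_vec_index[OF V] del: index_mult_mat)
qed

lemma psd_transpose_fst_choi_unitary:
  assumes V: "V \<in> carrier_mat d d"
  shows "psd_mat (d * d) (transpose_fst d (choi_jamiolkowski d (\<lambda>X. V * X * mat_adjoint V)))"
proof -
  \<comment> \<open>The vector stacks the columns of V: its entry at (a, b) is V[b,a]. Exchanging a
    and c in V[b,c] * cnj V[e,a] gives V[b,a] * cnj V[e,c], where the row label and the column label
    separate.\<close>
  define w where "w = vec (d * d) (\<lambda>k. V $$ (k mod d, k div d))"
  have "transpose_fst d (choi_jamiolkowski d (\<lambda>X. V * X * mat_adjoint V)) = ket_bra w w"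
  proof (rule eq_matI)
    fix k l
    assume "k < dim_row (ket_bra w w)" "l < dim_col (ket_bra w w)"
    then have k: "k < d * d" and l: "l < d * d" by (auto simp: ket_bra_def w_def)
    note b = div_mod_less_square[OF k] div_mod_less_square[OF l]
    show "transpose_fst d (choi_jamiolkowski d (\<lambda>X. V * X * mat_adjoint V)) $$ (k, l)
        = ket_bra w w $$ (k, l)"
      using k l b
      by (simp add: transpose_fst_def choi_unitary_index[OF V] pair_less_square ket_bra_def w_def)
  qed (auto simp: transpose_fst_def ket_bra_def w_def)
  then show ?thesis using psd_mat_ket_bra[of w "d * d"] by (simp add: w_def)
qed

text \<open>Summing over intermediate pairs (f, g), the identity factor acts as a Kronecker delta
  that fixes g to the second label of the row or column; only the sum over f remains.\<close>

lemma kron_one_mult_index: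
  assumes w: "\<omega> \<in> carrier_mat d d" and N: "N \<in> carrier_mat (d * d) (d * d)"
    and k: "k < d * d" and l: "l < d * d"
  shows "(kron_mat \<omega> (1\<^sub>m d) * N) $$ (k, l) = (\<Sum>f<d. \<omega> $$ (k div d, f) * N $$ (f * d + k mod d, l))"
    and "(N * kron_mat \<omega> (1\<^sub>m d)) $$ (k, l) = (\<Sum>f<d. N $$ (k, f * d + l mod d) * \<omega> $$ (f, l div d))"
proof -
  note bk = div_mod_less_square[OF k] and bl = div_mod_less_square[OF l]
  have ent: "kron_mat \<omega> (1\<^sub>m d) $$ (p, q) =
      (if p mod d = q mod d then \<omega> $$ (p div d, q div d) else 0)"
    if "p < d * d" "q < d * d" for p q
    using that w div_mod_less_square[OF that(1)] div_mod_less_square[OF that(2)]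
    by (auto simp: kron_mat_def)
  have "(kron_mat \<omega> (1\<^sub>m d) * N) $$ (k, l) =
      (\<Sum>f<d. \<Sum>g<d. kron_mat \<omega> (1\<^sub>m d) $$ (k, f * d + g) * N $$ (f * d + g, l))"
    unfolding mat_mult_index[OF kron_mat_carrier[OF w one_carrier_mat] N k l] by (rule sum_square_pairs)
  also have "\<dots> = (\<Sum>f<d. \<Sum>g<d. if g = k mod d then \<omega> $$ (k div d, f) * N $$ (f * d + k mod d, l) else 0)"
    by (intro sum.cong) (use k in \<open>auto simp: ent pair_less_square\<close>)
  finally show "(kron_mat \<omega> (1\<^sub>m d) * N) $$ (k, l)
      = (\<Sum>f<d. \<omega> $$ (k div d, f) * N $$ (f * d + k mod d, l))"
    using bk by simp
  have "(N * kron_mat \<omega> (1\<^sub>m d)) $$ (k, l) =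
      (\<Sum>f<d. \<Sum>g<d. N $$ (k, f * d + g) * kron_mat \<omega> (1\<^sub>m d) $$ (f * d + g, l))"
    unfolding mat_mult_index[OF N kron_mat_carrier[OF w one_carrier_mat] k l] by (rule sum_square_pairs)
  also have "\<dots> = (\<Sum>f<d. \<Sum>g<d. if g = l mod d then N $$ (k, f * d + l mod d) * \<omega> $$ (f, l div d) else 0)"
    by (intro sum.cong) (use l in \<open>auto simp: ent pair_less_square\<close>)
  finally show "(N * kron_mat \<omega> (1\<^sub>m d)) $$ (k, l)
      = (\<Sum>f<d. N $$ (k, f * d + l mod d) * \<omega> $$ (f, l div d))"
    using bl by simp
qed

lemma pseudo_density_carrier:
  assumes "\<omega> \<in> carrier_mat d d" "N \<in> carrier_mat (d * d) (d * d)"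
  shows "pseudo_density d \<omega> N \<in> carrier_mat (d * d) (d * d)"
  using assms kron_mat_carrier[OF assms(1) one_carrier_mat] by (simp add: pseudo_density_def)

text \<open>Each entry of the Choi-Jamiolkowski matrix is a product of an entry of V and an entry of
  V'. Multiplication by \<omega> on the left contracts only with V', on the right only with V. The
  products \<omega> V' and V \<omega> stay unexpanded so that the intertwining relations can rewrite
  them.\<close>

lemma pseudo_density_unitary_index:
  assumes V: "V \<in> carrier_mat d d" and w: "\<omega> \<in> carrier_mat d d"
    and k: "k < d * d" and l: "l < d * d"
  shows "pseudo_density d \<omega> (choi_jamiolkowski d (\<lambda>X. V * X * mat_adjoint V)) $$ (k, l) =
    1 / 2 * (V $$ (k mod d, l div d) * (\<omega> * mat_adjoint V) $$ (k div d, l mod d)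
      + (V * \<omega>) $$ (k mod d, l div d) * mat_adjoint V $$ (k div d, l mod d))"
proof -
  define N where "N = choi_jamiolkowski d (\<lambda>X. V * X * mat_adjoint V)"
  have V': "mat_adjoint V \<in> carrier_mat d d" using V by simp
  have N: "N \<in> carrier_mat (d * d) (d * d)" using choi_unitary_carrier[OF V] by (simp add: N_def)
  have Ni: "N $$ (p, q) = V $$ (p mod d, q div d) * cnj (V $$ (q mod d, p div d))"
    if "p < d * d" "q < d * d" for p q
    using choi_unitary_index[OF V that] by (simp add: N_def)
  have K: "kron_mat \<omega> (1\<^sub>m d) \<in> carrier_mat (d * d) (d * d)"
    by (rule kron_mat_carrier[OF w one_carrier_mat])
  note b = div_mod_less_square[OF k] div_mod_less_square[OF l]
  have 1: "(kron_mat \<omega> (1\<^sub>m d) * N) $$ (k, l)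
      = V $$ (k mod d, l div d) * (\<omega> * mat_adjoint V) $$ (k div d, l mod d)"
    unfolding kron_one_mult_index[OF w N k l] mat_mult_index[OF w V' b(1,4)] sum_distrib_left
    by (rule sum.cong) (use k l b in \<open>auto simp: Ni pair_less_square mat_adjoint_index[OF V]\<close>)
  have 2: "(N * kron_mat \<omega> (1\<^sub>m d)) $$ (k, l)
      = (V * \<omega>) $$ (k mod d, l div d) * mat_adjoint V $$ (k div d, l mod d)"
    unfolding kron_one_mult_index[OF w N k l] mat_mult_index[OF V w b(2,3)] sum_distrib_right
    by (rule sum.cong) (use k l b in \<open>auto simp: Ni pair_less_square mat_adjoint_index[OF V]\<close>)
  have "pseudo_density d \<omega> N $$ (k, l)
      = 1 / 2 * ((kron_mat \<omega> (1\<^sub>m d) * N) $$ (k, l) + (N * kron_mat \<omega> (1\<^sub>m d)) $$ (k, l))"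
    using K N k l by (simp add: pseudo_density_def del: index_mult_mat(1))
  then show ?thesis unfolding 1 2 by (simp only: N_def)
qed

section \<open>The swap operator\<close>

text \<open>The swap is a permutation matrix: the only summand that meets row k is the one with i =
  \<open>k div d\<close> and j = \<open>k mod d\<close>, and it places its 1 in the column of the
  pair (j, i).\<close>

lemma swap_mat_closed_index:
  "swap_mat d \<in> carrier_mat (d * d) (d * d) \<and>
    (\<forall>k<d * d. \<forall>l<d * d. swap_mat d $$ (k, l) =
      (if l = k mod d * d + k div d then 1 else 0))"
proof -
  define f where "f = (\<lambda>(i, j). ket_bra (kron_vec (unit_vec d i) (unit_vec d j))
                       (kron_vec (unit_vec d j) (unit_vec d i)))"
  have fc: "f p \<in> carrier_mat (d * d) (d * d)" for p
    by (auto simp: f_def kron_vec_def ket_bra_def split: prod.splits)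
  have S: "swap_mat d = msum (d * d) f ({0..<d} \<times> {0..<d})"
    by (simp add: swap_mat_def f_def)
  have "swap_mat d $$ (k, l) = (if l = k mod d * d + k div d then 1 else 0)"
    if k: "k < d * d" and l: "l < d * d" for k l
  proof -
    note b = div_mod_less_square[OF k] div_mod_less_square[OF l]
    \<comment> \<open>Quotient and remainder below d determine a label, so the equation splits into
      one for each factor.\<close>
    have eq: "l = k mod d * d + k div d \<longleftrightarrow> l div d = k mod d \<and> l mod d = k div d"
      using b by (metis div_mult_mod_eq div_mult_self3 div_less add.right_neutral mod_mult_self3
          mod_less not_less_zero)
    have fi: "f p $$ (k, l) = (if p = (k div d, k mod d)
        then (if l = k mod d * d + k div d then 1 else 0) else 0)"
      if "p \<in> {0..<d} \<times> {0..<d}" for p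
      unfolding eq
      using that k l b by (cases p) (auto simp: f_def kron_vec_def ket_bra_def)
    show ?thesis
      unfolding S using b k l
      by (subst msum_index) (simp_all add: fc fi sum.delta)
  qed
  moreover have "swap_mat d \<in> carrier_mat (d * d) (d * d)"
    unfolding S by (rule msum_closed) (simp_all add: fc)
  ultimately show ?thesis by blast
qed

lemmas swap_mat_carrier = swap_mat_closed_index[THEN conjunct1]
  and swap_mat_index = swap_mat_closed_index[THEN conjunct2, rule_format]

text \<open>Multiplication by a permutation matrix on the left relabels rows and by its adjoint on
  the right relabels columns; the entries 0 and 1 are unchanged by conjugation.\<close>

lemma swap_conjugation_index:
  assumes A: "A \<in> carrier_mat (d * d) (d * d)" and k: "k < d * d" and l: "l < d * d"
  shows "(swap_mat d * A * mat_adjoint (swap_mat d)) $$ (k, l)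
    = A $$ (k mod d * d + k div d, l mod d * d + l div d)"
proof -
  have S: "swap_mat d \<in> carrier_mat (d * d) (d * d)" by (rule swap_mat_carrier)
  have S': "mat_adjoint (swap_mat d) \<in> carrier_mat (d * d) (d * d)" using S by simp
  have SA: "swap_mat d * A \<in> carrier_mat (d * d) (d * d)" using S A by simp
  have sk: "k mod d * d + k div d < d * d" and sl: "l mod d * d + l div d < d * d"
    using k l by (auto intro!: pair_less_square div_mod_less_square)
  have "(swap_mat d * A) $$ (k, q) = A $$ (k mod d * d + k div d, q)" if q: "q < d * d" for q
  proof -
    have "(swap_mat d * A) $$ (k, q)
        = (\<Sum>p<d * d. if p = k mod d * d + k div d then A $$ (k mod d * d + k div d, q) else 0)"
      unfolding mat_mult_index[OF S A k q]
      by (rule sum.cong) (use k in \<open>auto simp: swap_mat_index\<close>)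
    then show ?thesis using sk by simp
  qed
  then have "(swap_mat d * A * mat_adjoint (swap_mat d)) $$ (k, l)
      = (\<Sum>q<d * d. if q = l mod d * d + l div d
          then A $$ (k mod d * d + k div d, l mod d * d + l div d) else 0)"
    unfolding mat_mult_index[OF SA S' k l]
    by (intro sum.cong)
      (use l in \<open>auto simp: mat_adjoint_index[OF S] swap_mat_index simp del: index_mult_mat\<close>)
  then show ?thesis using sl by simp
qed

lemma swap_pseudo_density_unitary:
  assumes U: "unitary_mat d U" and rho: "\<rho> \<in> carrier_mat d d"
  shows "swap_mat d * pseudo_density d \<rho> (choi_jamiolkowski d (\<lambda>X. U * X * mat_adjoint U))
      * mat_adjoint (swap_mat d)
    = pseudo_density d (U * \<rho> * mat_adjoint U) (choi_jamiolkowski d (\<lambda>X. mat_adjoint U * X * U))"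
    (is "?L = ?R")
proof -
  define R where "R = pseudo_density d \<rho> (choi_jamiolkowski d (\<lambda>X. U * X * mat_adjoint U))"
  have Uc: "U \<in> carrier_mat d d" and Uc': "mat_adjoint U \<in> carrier_mat d d"
    using U by (auto simp: unitary_mat_def)
  have gc: "U * \<rho> * mat_adjoint U \<in> carrier_mat d d"
    using Uc Uc' rho by (intro mult_carrier_mat[of _ d d])
  \<comment> \<open>The results above concern channels of the form V X V'. For V = U' the right
    factor is a double adjoint, which this equation turns back into U.\<close>
  have UU: "mat_adjoint (mat_adjoint U) = U" by (rule mat_adjoint_mat_adjoint[OF Uc])
  have Rc: "R \<in> carrier_mat (d * d) (d * d)"
    unfolding R_def by (intro pseudo_density_carrier rho choi_unitary_carrier Uc)
  have Lc: "?L \<in> carrier_mat (d * d) (d * d)"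
    unfolding R_def[symmetric]
    by (intro mult_carrier_mat[of _ _ "d * d"] mat_adjoint_carrier swap_mat_carrier Rc)
  have rc: "?R \<in> carrier_mat (d * d) (d * d)"
    using choi_unitary_carrier[OF Uc', unfolded UU] by (intro pseudo_density_carrier gc)
  show ?thesis
  proof (rule eq_matI)
    fix k l
    assume "k < dim_row ?R" "l < dim_col ?R"
    then have k: "k < d * d" and l: "l < d * d" using rc by auto
    note b = div_mod_less_square[OF k] div_mod_less_square[OF l]
    have "?L $$ (k, l) = R $$ (k mod d * d + k div d, l mod d * d + l div d)"
      unfolding R_def[symmetric] by (rule swap_conjugation_index[OF Rc k l])
    also have "\<dots> = 1 / 2 * (U $$ (k div d, l mod d) * (\<rho> * mat_adjoint U) $$ (k mod d, l div d)
        + (U * \<rho>) $$ (k div d, l mod d) * mat_adjoint U $$ (k mod d, l div d))"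
      unfolding R_def using b
      by (subst pseudo_density_unitary_index[OF Uc rho])
        (simp_all add: pair_less_square del: index_mult_mat)
    \<comment> \<open>The two halves of the symmetrised product trade places. With k = (a, b) and l
      = (c, e), the term U'[b,c] (\<gamma> U)[a,e] becomes U'[b,c] (U \<rho>)[a,e], the second
      summand above, and (U' \<gamma>)[b,c] U[a,e] becomes (\<rho> U')[b,c] U[a,e], the
      first.\<close>
    also have "\<dots> = ?R $$ (k, l)"
      using pseudo_density_unitary_index[OF Uc' gc k l, unfolded UU
          unitary_conjugation_cancel[OF U rho]]
      by (simp add: ac_simps del: index_mult_mat)
    finally show "?L $$ (k, l) = ?R $$ (k, l)" .
  qed (use Lc rc in auto)
qed

text \<open>The clauses on \<open>density_mat\<close> and on the two compositions of
  \<open>\<E>\<close> and \<open>\<E>'\<close> make precise that \<gamma> is a legitimate initial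
  state and that the reversed process runs through the inverse channel.\<close>

theorem mainTheorem3:
  fixes n d :: nat
    and \<rho> U M R S R' \<gamma> M' :: "complex mat"
    and \<E> \<E>' :: "complex mat \<Rightarrow> complex mat"
  assumes d: "d = 2 ^ n"
    and rho: "density_mat d \<rho>"
    and U: "unitary_mat d U"
    and E: "\<E> = (\<lambda>X. U * X * mat_adjoint U)"
    and M: "M = choi_jamiolkowski d \<E>"
    and R: "R = pseudo_density d \<rho> M"
    and S: "S = swap_mat d"
    and R': "R' = S * R * mat_adjoint S"
    and gamma: "\<gamma> = \<E> \<rho>"
    and M': "M' = msum (d * d)
      (\<lambda>(i, j). kron_mat (ket_bra (unit_vec d i) (unit_vec d j))
                  (mat_adjoint U * ket_bra (unit_vec d j) (unit_vec d i) * U))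
      ({0..<d} \<times> {0..<d})"
    and E': "\<E>' = (\<lambda>X. mat_adjoint U * X * U)"
  shows "R' = (1 / 2) \<cdot>\<^sub>m (kron_mat \<gamma> (1\<^sub>m d) * M' + M' * kron_mat \<gamma> (1\<^sub>m d))
    \<and> density_mat d \<gamma>
    \<and> (\<forall>X \<in> carrier_mat d d. \<E>' (\<E> X) = X \<and> \<E> (\<E>' X) = X)
    \<and> R' = pseudo_density d \<gamma> (choi_jamiolkowski d \<E>')
    \<and> psd_mat (d * d) (transpose_fst d M)
    \<and> psd_mat (d * d) (transpose_fst d M')"
proof -
  have rc: "\<rho> \<in> carrier_mat d d" using rho by (simp add: density_mat_def psd_mat_def)
  have Uc: "U \<in> carrier_mat d d" and Uc': "mat_adjoint U \<in> carrier_mat d d"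
    using U by (auto simp: unitary_mat_def)
  have UU: "mat_adjoint (mat_adjoint U) = U" by (rule mat_adjoint_mat_adjoint[OF Uc])
  have M'_choi: "M' = choi_jamiolkowski d \<E>'"
    by (simp add: M' E' choi_jamiolkowski_def)
  have R'_eq: "R' = pseudo_density d \<gamma> (choi_jamiolkowski d \<E>')"
    unfolding R' S R M E E' gamma by (rule swap_pseudo_density_unitary[OF U rc])
  \<comment> \<open>The second composition is the first one for the unitary U', whose adjoint is
    U.\<close>
  have "\<E>' (\<E> X) = X \<and> \<E> (\<E>' X) = X" if "X \<in> carrier_mat d d" for X
    using unitary_conjugation_inverse[OF U that]
      unitary_conjugation_inverse[OF unitary_mat_adjoint[OF U] that]
    by (simp add: E E' UU)
  moreover have "density_mat d \<gamma>"
    unfolding gamma E by (rule density_mat_unitary_conjugation[OF U rho])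
  moreover have "psd_mat (d * d) (transpose_fst d M)"
    unfolding M E by (rule psd_transpose_fst_choi_unitary[OF Uc])
  moreover have "psd_mat (d * d) (transpose_fst d M')"
    unfolding M'_choi E' using psd_transpose_fst_choi_unitary[OF Uc'] by (simp only: UU)
  ultimately show ?thesis
    using R'_eq by (simp add: M'_choi pseudo_density_def)
qed

end
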